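(* Let $U\subset X$ be $1$-quasiopen and let $\{U_j\}_{j=1}^\infty$ be a $1$-strict quasicovering of $U$ with associated Newton-Sobolev functions $\rho_j\in N^{1,1}_c(U)$, where $0\le\rho_j\le1$ and $\rho_j=1$ in $U_j$ for each $j\in\mathbb N$. Then there exist functions $\eta_j\in N^{1,1}_c(U)$, $j\in\mathbb N$, such that $\eta_1=\rho_1$, $0\le\eta_j\le\rho_j$ for all $j\in\mathbb N$, $\sum_{j=1}^\infty\eta_j=1$ $1$-q.e. in $U$, and $1$-q.e. $x\in U$ has a $1$-fine neighborhood where $\eta_j\ne0$ for only finitely many $j\in\mathbb N$.
   Context: Setting. $(X,d,\mu)$ is a complete metric space equipped with a Borel regular outer measure $\mu$ that is doubling: there is $C_d\ge 1$ with $0<\mu(B(x,2r))\le C_d\,\mu(B(x,r))<\infty$ for every ball $B(x,r)=\{y\in X: d(y,x)<r\}$. Functions take values in $[-\infty,\infty]$. Upper gradients. A curve is a rectifiable continuous map from a compact interval into $X$. A nonnegative Borel function $g$ is an upper gradient of $u$ in a set $A\subset X$ if for all nonconstant curves $\gamma$ in $A$ with end points $x,y$ we have $|u(x)-u(y)|\le\int_\gamma g\,ds$ (the left side is interpreted as $\infty$ if $|u(x)|$ or $|u(y)|$ is infinite). A family of curves has zero $1$-modulus if there is a nonnegative Borel $\rho\in L^1(X)$ with $\int_\gamma\rho\,ds=\infty$ for all $\gamma$ in the family. A nonnegative $\mu$-measurable $g$ is a $1$-weak upper gradient of $u$ in $A$ if the inequality holds for all curves in $A$ outside a family of zero $1$-modulus.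 $X$ is assumed to support a $(1,1)$-Poincaré inequality: there are $C_P>0$, $\lambda\ge1$ such that for every ball $B(x,r)$, every $u\in L^1_{\mathrm{loc}}(X)$ and every upper gradient $g$ of $u$ in $X$, $$\frac1{\mu(B(x,r))}\int_{B(x,r)}|u-u_{B(x,r)}|\,d\mu\le C_P r\,\frac1{\mu(B(x,\lambda r))}\int_{B(x,\lambda r)}g\,d\mu,$$ where $u_{B(x,r)}$ is the integral average of $u$ over $B(x,r)$. Newton-Sobolev spaces. $\Vert u\Vert_{N^{1,1}(X)}=\Vert u\Vert_{L^1(X)}+\inf\Vert g\Vert_{L^1(X)}$, the infimum over all $1$-weak upper gradients $g$ of $u$ in $X$, and $N^{1,1}(X)=\{u:\Vert u\Vert_{N^{1,1}(X)}<\infty\}$ (functions defined everywhere). Each $u\in N^{1,1}(X)$ has a minimal (a.e. smallest) $1$-weak upper gradient $g_u$. For $H\subset X$, $N^{1,1}_0(H)$ is the class of $u\in N^{1,1}(X)$ with $u=0$ on $X\setminus H$, and $N^{1,1}_c(H)$ is the class of $u\in N^{1,1}(X)$ whose support is a compact subset of $H$. Capacities. $\mathrm{Cap}_1(A)=\inf\Vert u\Vert_{N^{1,1}(X)}$ over $u\in N^{1,1}(X)$ with $u\ge1$ in $A$. "$1$-q.e." means outside a set of zero $\mathrm{Cap}_1$. For $A\subset H\subset X$, $\mathrm{cap}_1(A,H)=\inf\int_X g_u\,d\mu$ over $u\in N^{1,1}_0(H)$ with $u\ge1$ in $A$. $U\subset X$ is $1$-quasiopen if for every $\varepsilon>0$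 there is an open $G\subset X$ with $\mathrm{Cap}_1(G)<\varepsilon$ and $U\cup G$ open. Fine topology. $A\subset X$ is $1$-thin at $x$ if $\lim_{r\to0} r\,\mathrm{cap}_1(A\cap B(x,r),B(x,2r))/\mu(B(x,r))=0$. A set $V$ is $1$-finely open if $X\setminus V$ is $1$-thin at every $x\in V$; these sets form the $1$-fine topology, and $1$-fine neighborhoods are neighborhoods in this topology. Quasicoverings. A set $A\subset D$ is a $1$-strict subset of $D$ if there is $\eta\in N^{1,1}_0(D)$ with $\eta=1$ in $A$. A countable family $\{U_j\}_{j=1}^\infty$ of $1$-quasiopen sets is a quasicovering of a $1$-quasiopen set $U$ if $\bigcup_jU_j\subset U$ and $\mathrm{Cap}_1(U\setminus\bigcup_jU_j)=0$. If moreover every $U_j$ is a $1$-finely open $1$-strict subset of $U$ and $\overline{U_j}$ is a compact subset of $U$, then $\{U_j\}$ is a $1$-strict quasicovering of $U$; associated Newton-Sobolev functions are functions $\rho_j$ as in the definition of $1$-strict subset, i.e. with $\rho_j=1$ in $U_j$. *)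

theory Defs
  imports "HOL-Analysis.Analysis"
begin

section \<open>Borel regular doubling outer measures\<close>

definition borel_regular_outer_measure :: "('a::metric_space set \<Rightarrow> ennreal) \<Rightarrow> bool" where
  "borel_regular_outer_measure \<mu> \<longleftrightarrow>
     outer_measure_space UNIV \<mu> \<and>
     sets borel \<subseteq> lambda_system UNIV UNIV \<mu> \<and>
     (\<forall>A. \<exists>B\<in>sets borel. A \<subseteq> B \<and> \<mu> B = \<mu> A)"

text \<open>The restriction of an outer measure to its Caratheodory-measurable sets.  Measurability
  and integration with respect to \<open>\<mu>\<close> always refer to this (complete) measure space.\<close>

definition caratheodory_space :: "('a set \<Rightarrow> ennreal) \<Rightarrow> 'a measure" where
  "caratheodory_space \<mu> = measure_of UNIV (lambda_system UNIV UNIV \<mu>) \<mu>"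

definition doubling :: "('a::metric_space set \<Rightarrow> ennreal) \<Rightarrow> bool" where
  "doubling \<mu> \<longleftrightarrow>
     (\<exists>Cd::real. Cd \<ge> 1 \<and>
        (\<forall>x. \<forall>r>0. 0 < \<mu> (ball x (2 * r)) \<and>
           \<mu> (ball x (2 * r)) \<le> ennreal Cd * \<mu> (ball x r) \<and>
           ennreal Cd * \<mu> (ball x r) < \<infinity>))"


section \<open>Curves and line integrals\<close>

text \<open>A triple \<open>(a, b, \<gamma>)\<close> stands for the restriction of \<open>\<gamma>\<close> to \<open>{a..b}\<close>.\<close>

type_synonym 'a curve = "real \<times> real \<times> (real \<Rightarrow> 'a)"

definition curve_length :: "real \<Rightarrow> real \<Rightarrow> (real \<Rightarrow> 'a::metric_space) \<Rightarrow> ennreal" where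
  "curve_length a b \<gamma> =
     (SUP (n, t) \<in> {(n::nat, t::nat \<Rightarrow> real). mono_on {..n} t \<and> t ` {..n} \<subseteq> {a..b}}.
        \<Sum>i<n. ennreal (dist (\<gamma> (t i)) (\<gamma> (t (Suc i)))))"

fun is_curve :: "'a::metric_space curve \<Rightarrow> bool" where
  "is_curve (a, b, \<gamma>) \<longleftrightarrow> a \<le> b \<and> continuous_on {a..b} \<gamma> \<and> curve_length a b \<gamma> < \<infinity>"

fun curve_image :: "'a curve \<Rightarrow> 'a set" where
  "curve_image (a, b, \<gamma>) = \<gamma> ` {a..b}"

fun curve_start :: "'a curve \<Rightarrow> 'a" where
  "curve_start (a, b, \<gamma>) = \<gamma> a"

fun curve_end :: "'a curve \<Rightarrow> 'a" where
  "curve_end (a, b, \<gamma>) = \<gamma> b"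

definition nonconstant_curve :: "'a curve \<Rightarrow> bool" where
  "nonconstant_curve c \<longleftrightarrow> (\<exists>x\<in>curve_image c. \<exists>y\<in>curve_image c. x \<noteq> y)"

text \<open>Arc-length parametrization \<open>{0..length} \<rightarrow> X\<close>.  The choice of \<open>t\<close> is immaterial, since a
  curve is constant on every interval on which its length function is constant.\<close>

definition arclength_param :: "real \<Rightarrow> real \<Rightarrow> (real \<Rightarrow> 'a::metric_space) \<Rightarrow> real \<Rightarrow> 'a" where
  "arclength_param a b \<gamma> s = \<gamma> (SOME t. t \<in> {a..b} \<and> curve_length a t \<gamma> = ennreal s)"

text \<open>The line integral \<open>\<integral>\<^sub>\<gamma> g ds\<close>.  For a Borel function \<open>g\<close> the integrand is measurable.
  If \<open>g\<close> is only \<open>\<mu>\<close>-measurable, then for all curves outside a family of zero modulus the integrand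
  is still Lebesgue measurable, so that the value given to other integrals is immaterial.\<close>

fun line_integral :: "('a::metric_space \<Rightarrow> ennreal) \<Rightarrow> 'a curve \<Rightarrow> ennreal" where
  "line_integral g (a, b, \<gamma>) =
     (\<integral>\<^sup>+ s \<in> {0..enn2real (curve_length a b \<gamma>)}. g (arclength_param a b \<gamma> s) \<partial>lebesgue)"


section \<open>Upper gradients\<close>

definition osc :: "ereal \<Rightarrow> ereal \<Rightarrow> ennreal" where
  "osc p q = (if \<bar>p\<bar> = \<infinity> \<or> \<bar>q\<bar> = \<infinity> then \<infinity> else e2ennreal \<bar>p - q\<bar>)"

definition ug_inequality ::
    "('a::metric_space \<Rightarrow> ereal) \<Rightarrow> ('a \<Rightarrow> ennreal) \<Rightarrow> 'a curve \<Rightarrow> bool" where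
  "ug_inequality u g c \<longleftrightarrow> osc (u (curve_start c)) (u (curve_end c)) \<le> line_integral g c"

definition upper_gradient ::
    "'a::metric_space set \<Rightarrow> ('a \<Rightarrow> ereal) \<Rightarrow> ('a \<Rightarrow> ennreal) \<Rightarrow> bool" where
  "upper_gradient A u g \<longleftrightarrow>
     g \<in> borel_measurable borel \<and>
     (\<forall>c. is_curve c \<and> nonconstant_curve c \<and> curve_image c \<subseteq> A \<longrightarrow> ug_inequality u g c)"

definition zero_modulus :: "('a::metric_space set \<Rightarrow> ennreal) \<Rightarrow> 'a curve set \<Rightarrow> bool" where
  "zero_modulus \<mu> \<Gamma> \<longleftrightarrow>
     (\<exists>\<rho>. \<rho> \<in> borel_measurable borel \<and> (\<integral>\<^sup>+ x. \<rho> x \<partial>caratheodory_space \<mu>) < \<infinity> \<and>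
          (\<forall>c\<in>\<Gamma>. line_integral \<rho> c = \<infinity>))"

definition weak_upper_gradient ::
    "('a::metric_space set \<Rightarrow> ennreal) \<Rightarrow> 'a set \<Rightarrow> ('a \<Rightarrow> ereal) \<Rightarrow> ('a \<Rightarrow> ennreal) \<Rightarrow> bool" where
  "weak_upper_gradient \<mu> A u g \<longleftrightarrow>
     g \<in> borel_measurable (caratheodory_space \<mu>) \<and>
     (\<exists>\<Gamma>. zero_modulus \<mu> \<Gamma> \<and>
        (\<forall>c. is_curve c \<and> nonconstant_curve c \<and> curve_image c \<subseteq> A \<and> c \<notin> \<Gamma>
             \<longrightarrow> ug_inequality u g c))"


section \<open>The Poincare inequality\<close>

definition L1_loc :: "('a::metric_space set \<Rightarrow> ennreal) \<Rightarrow> ('a \<Rightarrow> ereal) set" where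
  "L1_loc \<mu> = {u. u \<in> borel_measurable (caratheodory_space \<mu>) \<and>
     (\<forall>x. \<exists>r>0. (\<integral>\<^sup>+ y \<in> ball x r. e2ennreal \<bar>u y\<bar> \<partial>caratheodory_space \<mu>) < \<infinity>)}"

definition ball_average ::
    "('a::metric_space set \<Rightarrow> ennreal) \<Rightarrow> ('a \<Rightarrow> ereal) \<Rightarrow> 'a \<Rightarrow> real \<Rightarrow> real" where
  "ball_average \<mu> u x r =
     (LINT y:ball x r|caratheodory_space \<mu>. real_of_ereal (u y)) / enn2real (\<mu> (ball x r))"

definition poincare_1_1 :: "('a::metric_space set \<Rightarrow> ennreal) \<Rightarrow> bool" where
  "poincare_1_1 \<mu> \<longleftrightarrow>
     (\<exists>CP l::real. CP > 0 \<and> l \<ge> 1 \<and>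
        (\<forall>x. \<forall>r>0. \<forall>u\<in>L1_loc \<mu>. \<forall>g. upper_gradient UNIV u g \<longrightarrow>
           (\<integral>\<^sup>+ y \<in> ball x r. e2ennreal \<bar>u y - ereal (ball_average \<mu> u x r)\<bar> \<partial>caratheodory_space \<mu>)
               / \<mu> (ball x r)
           \<le> ennreal (CP * r) *
             ((\<integral>\<^sup>+ y \<in> ball x (l * r). g y \<partial>caratheodory_space \<mu>) / \<mu> (ball x (l * r)))))"


section \<open>Newton--Sobolev functions\<close>

definition N11_norm :: "('a::metric_space set \<Rightarrow> ennreal) \<Rightarrow> ('a \<Rightarrow> ereal) \<Rightarrow> ennreal" where
  "N11_norm \<mu> u =
     (\<integral>\<^sup>+ x. e2ennreal \<bar>u x\<bar> \<partial>caratheodory_space \<mu>) +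
     (INF g \<in> {g. weak_upper_gradient \<mu> UNIV u g}. \<integral>\<^sup>+ x. g x \<partial>caratheodory_space \<mu>)"

definition N11 :: "('a::metric_space set \<Rightarrow> ennreal) \<Rightarrow> ('a \<Rightarrow> ereal) set" where
  "N11 \<mu> = {u. u \<in> borel_measurable (caratheodory_space \<mu>) \<and> N11_norm \<mu> u < \<infinity>}"

text \<open>Minimality is among integrable weak upper gradients: a non-integrable \<open>g\<close> with
  \<open>\<integral>\<^sub>\<gamma> g ds = \<infinity>\<close> on all curves is always a weak upper gradient, but may vanish on a set of positive
  measure.\<close>

definition is_minimal_wug ::
    "('a::metric_space set \<Rightarrow> ennreal) \<Rightarrow> ('a \<Rightarrow> ereal) \<Rightarrow> ('a \<Rightarrow> ennreal) \<Rightarrow> bool" where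
  "is_minimal_wug \<mu> u g \<longleftrightarrow>
     weak_upper_gradient \<mu> UNIV u g \<and> (\<integral>\<^sup>+ x. g x \<partial>caratheodory_space \<mu>) < \<infinity> \<and>
     (\<forall>g'. weak_upper_gradient \<mu> UNIV u g' \<and> (\<integral>\<^sup>+ x. g' x \<partial>caratheodory_space \<mu>) < \<infinity> \<longrightarrow>
           (AE x in caratheodory_space \<mu>. g x \<le> g' x))"

definition minimal_wug ::
    "('a::metric_space set \<Rightarrow> ennreal) \<Rightarrow> ('a \<Rightarrow> ereal) \<Rightarrow> 'a \<Rightarrow> ennreal" where
  "minimal_wug \<mu> u = (SOME g. is_minimal_wug \<mu> u g)"

definition N11_0 :: "('a::metric_space set \<Rightarrow> ennreal) \<Rightarrow> 'a set \<Rightarrow> ('a \<Rightarrow> ereal) set" where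
  "N11_0 \<mu> H = {u \<in> N11 \<mu>. \<forall>x. x \<notin> H \<longrightarrow> u x = 0}"

definition N11_c :: "('a::metric_space set \<Rightarrow> ennreal) \<Rightarrow> 'a set \<Rightarrow> ('a \<Rightarrow> ereal) set" where
  "N11_c \<mu> H = {u \<in> N11 \<mu>. compact (closure {x. u x \<noteq> 0}) \<and> closure {x. u x \<noteq> 0} \<subseteq> H}"


section \<open>Capacities and quasiopen sets\<close>

definition Cap1 :: "('a::metric_space set \<Rightarrow> ennreal) \<Rightarrow> 'a set \<Rightarrow> ennreal" where
  "Cap1 \<mu> A = (INF u \<in> {u \<in> N11 \<mu>. \<forall>x\<in>A. u x \<ge> 1}. N11_norm \<mu> u)"

definition quasi_everywhere_in ::
    "('a::metric_space set \<Rightarrow> ennreal) \<Rightarrow> 'a set \<Rightarrow> ('a \<Rightarrow> bool) \<Rightarrow> bool" where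
  "quasi_everywhere_in \<mu> A P \<longleftrightarrow> Cap1 \<mu> {x \<in> A. \<not> P x} = 0"

definition rel_cap1 :: "('a::metric_space set \<Rightarrow> ennreal) \<Rightarrow> 'a set \<Rightarrow> 'a set \<Rightarrow> ennreal" where
  "rel_cap1 \<mu> A H =
     (INF u \<in> {u \<in> N11_0 \<mu> H. \<forall>x\<in>A. u x \<ge> 1}. \<integral>\<^sup>+ x. minimal_wug \<mu> u x \<partial>caratheodory_space \<mu>)"

definition quasiopen :: "('a::metric_space set \<Rightarrow> ennreal) \<Rightarrow> 'a set \<Rightarrow> bool" where
  "quasiopen \<mu> U \<longleftrightarrow> (\<forall>\<epsilon>::real. \<epsilon> > 0 \<longrightarrow> (\<exists>G. open G \<and> Cap1 \<mu> G < ennreal \<epsilon> \<and> open (U \<union> G)))"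


section \<open>Fine topology\<close>

definition thin_at :: "('a::metric_space set \<Rightarrow> ennreal) \<Rightarrow> 'a set \<Rightarrow> 'a \<Rightarrow> bool" where
  "thin_at \<mu> A x \<longleftrightarrow>
     ((\<lambda>r::real. ennreal r * rel_cap1 \<mu> (A \<inter> ball x r) (ball x (2 * r)) / \<mu> (ball x r))
        \<longlongrightarrow> 0) (at_right 0)"

definition finely_open :: "('a::metric_space set \<Rightarrow> ennreal) \<Rightarrow> 'a set \<Rightarrow> bool" where
  "finely_open \<mu> V \<longleftrightarrow> (\<forall>x\<in>V. thin_at \<mu> (- V) x)"

definition fine_neighborhood ::
    "('a::metric_space set \<Rightarrow> ennreal) \<Rightarrow> 'a \<Rightarrow> 'a set \<Rightarrow> bool" where
  "fine_neighborhood \<mu> x N \<longleftrightarrow> (\<exists>V. finely_open \<mu> V \<and> x \<in> V \<and> V \<subseteq> N)"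


section \<open>Quasicoverings\<close>

definition strict_subset :: "('a::metric_space set \<Rightarrow> ennreal) \<Rightarrow> 'a set \<Rightarrow> 'a set \<Rightarrow> bool" where
  "strict_subset \<mu> A D \<longleftrightarrow> A \<subseteq> D \<and> (\<exists>\<eta>\<in>N11_0 \<mu> D. \<forall>x\<in>A. \<eta> x = 1)"

definition quasicovering ::
    "('a::metric_space set \<Rightarrow> ennreal) \<Rightarrow> 'a set \<Rightarrow> (nat \<Rightarrow> 'a set) \<Rightarrow> bool" where
  "quasicovering \<mu> U Us \<longleftrightarrow>
     quasiopen \<mu> U \<and> (\<forall>j. quasiopen \<mu> (Us j)) \<and>
     (\<Union>j. Us j) \<subseteq> U \<and> Cap1 \<mu> (U - (\<Union>j. Us j)) = 0"

definition strict_quasicovering ::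
    "('a::metric_space set \<Rightarrow> ennreal) \<Rightarrow> 'a set \<Rightarrow> (nat \<Rightarrow> 'a set) \<Rightarrow> bool" where
  "strict_quasicovering \<mu> U Us \<longleftrightarrow>
     quasicovering \<mu> U Us \<and>
     (\<forall>j. finely_open \<mu> (Us j) \<and> strict_subset \<mu> (Us j) U \<and>
          compact (closure (Us j)) \<and> closure (Us j) \<subseteq> U)"

end

theory Submission
  imports Defs
begin

text \<open>Let \<open>M j\<close> be the maximum of \<open>\<rho> 0, \<dots>, \<rho> (j - 1)\<close> and let \<open>\<eta> j = M (j + 1) - M j\<close>, which is
  the positive part of \<open>\<rho> j - M j\<close>.  The partial sums of the \<open>\<eta> j\<close> telescope to \<open>M n\<close>.  On \<open>Us j\<close> we
  have \<open>M n = 1\<close> for all \<open>n > j\<close>, so there the sum is \<open>1\<close> and only finitely many \<open>\<eta> k\<close> are nonzero;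
  moreover \<open>Us j\<close> is finely open, and the sets \<open>Us j\<close> cover quasi-every point of \<open>U\<close>.\<close>

text \<open>The integrands need not be measurable: \<open>nn_integral\<close> is a lower integral.  Thus no
  measurability along curves is needed when weak upper gradients are added.\<close>

lemma nn_integral_superadditive:
  "(\<integral>\<^sup>+ x. f x \<partial>M) + (\<integral>\<^sup>+ x. g x \<partial>M) \<le> (\<integral>\<^sup>+ x. f x + g x \<partial>M)"
proof -
  let ?S = "\<lambda>f. {s. simple_function M s \<and> s \<le> f}"
  have ne: "?S f \<noteq> {}" for f :: "'a \<Rightarrow> ennreal"
  proof -
    have "(\<lambda>_. 0) \<in> ?S f" by (auto simp: le_fun_def)
    then show ?thesis by blast
  qed
  have *: "integral\<^sup>S M s + integral\<^sup>S M t \<le> (\<integral>\<^sup>+ x. f x + g x \<partial>M)"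
    if "s \<in> ?S f" "t \<in> ?S g" for s t
  proof -
    have "integral\<^sup>S M s + integral\<^sup>S M t = (\<integral>\<^sup>S x. s x + t x \<partial>M)"
      using that by (simp add: simple_integral_add)
    also have "\<dots> = (\<integral>\<^sup>+ x. s x + t x \<partial>M)"
      using that by (subst nn_integral_eq_simple_integral) auto
    also have "\<dots> \<le> (\<integral>\<^sup>+ x. f x + g x \<partial>M)"
      using that by (intro nn_integral_mono add_mono) (auto simp: le_fun_def)
    finally show ?thesis .
  qed
  have "(\<integral>\<^sup>+ x. f x \<partial>M) + integral\<^sup>S M t \<le> (\<integral>\<^sup>+ x. f x + g x \<partial>M)" if "t \<in> ?S g" for t
    unfolding nn_integral_def[of M f] ennreal_SUP_add_left[OF ne, symmetric]
    using * that by (intro SUP_least) auto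
  then show ?thesis
    unfolding nn_integral_def[of M g] ennreal_SUP_add_right[OF ne]
    by (intro SUP_least) auto
qed

lemma line_integral_superadditive:
  "line_integral f c + line_integral g c \<le> line_integral (\<lambda>x. f x + g x) c"
proof (cases c)
  case (fields a b \<gamma>)
  show ?thesis
    using nn_integral_superadditive[of lebesgue
        "\<lambda>s. f (arclength_param a b \<gamma> s) * indicator {0..enn2real (curve_length a b \<gamma>)} s"
        "\<lambda>s. g (arclength_param a b \<gamma> s) * indicator {0..enn2real (curve_length a b \<gamma>)} s"]
    by (simp add: fields distrib_right)
qed

lemma borel_measurable_caratheodory_space:
  assumes "borel_regular_outer_measure \<mu>" and "f \<in> borel_measurable borel"
  shows "f \<in> borel_measurable (caratheodory_space \<mu>)"
proof -
  have "sets borel \<subseteq> sets (caratheodory_space \<mu>)"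
    using assms(1) unfolding borel_regular_outer_measure_def caratheodory_space_def
    by (auto simp: sets_measure_of_conv)
  moreover have "space (caratheodory_space \<mu>) = UNIV"
    by (simp add: caratheodory_space_def space_measure_of_conv)
  ultimately show ?thesis
    using assms(2) by (auto simp: measurable_def)
qed

lemma zero_modulus_empty: "zero_modulus \<mu> {}"
  unfolding zero_modulus_def by (rule exI[of _ "\<lambda>_. 0"]) auto

lemma zero_modulus_Un:
  assumes \<mu>: "borel_regular_outer_measure \<mu>"
    and "zero_modulus \<mu> \<Gamma>1" and "zero_modulus \<mu> \<Gamma>2"
  shows "zero_modulus \<mu> (\<Gamma>1 \<union> \<Gamma>2)"
proof -
  obtain r1 where r1: "r1 \<in> borel_measurable borel"
      "(\<integral>\<^sup>+ x. r1 x \<partial>caratheodory_space \<mu>) < \<infinity>" "\<And>c. c \<in> \<Gamma>1 \<Longrightarrow> line_integral r1 c = \<infinity>"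
    using assms(2) unfolding zero_modulus_def by blast
  obtain r2 where r2: "r2 \<in> borel_measurable borel"
      "(\<integral>\<^sup>+ x. r2 x \<partial>caratheodory_space \<mu>) < \<infinity>" "\<And>c. c \<in> \<Gamma>2 \<Longrightarrow> line_integral r2 c = \<infinity>"
    using assms(3) unfolding zero_modulus_def by blast
  have "(\<integral>\<^sup>+ x. r1 x + r2 x \<partial>caratheodory_space \<mu>) < \<infinity>"
    using r1 r2 borel_measurable_caratheodory_space[OF \<mu>] by (subst nn_integral_add) auto
  moreover have "line_integral (\<lambda>x. r1 x + r2 x) c = \<infinity>" if "c \<in> \<Gamma>1 \<union> \<Gamma>2" for c
    using line_integral_superadditive[of r1 c r2] r1(3)[of c] r2(3)[of c] that
    by (auto simp: top_unique)
  ultimately show ?thesis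
    using r1(1) r2(1) unfolding zero_modulus_def
    by (intro exI[of _ "\<lambda>x. r1 x + r2 x"]) auto
qed

lemma weak_upper_gradient_add:
  assumes \<mu>: "borel_regular_outer_measure \<mu>"
    and "weak_upper_gradient \<mu> A u g" and "weak_upper_gradient \<mu> A v h"
    and osc: "\<And>x y. osc (w x) (w y) \<le> osc (u x) (u y) + osc (v x) (v y)"
  shows "weak_upper_gradient \<mu> A w (\<lambda>x. g x + h x)"
proof -
  obtain \<Gamma>1 where \<Gamma>1: "zero_modulus \<mu> \<Gamma>1"
      "\<And>c. is_curve c \<Longrightarrow> nonconstant_curve c \<Longrightarrow> curve_image c \<subseteq> A \<Longrightarrow> c \<notin> \<Gamma>1 \<Longrightarrow> ug_inequality u g c"
    using assms(2) unfolding weak_upper_gradient_def by blast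
  obtain \<Gamma>2 where \<Gamma>2: "zero_modulus \<mu> \<Gamma>2"
      "\<And>c. is_curve c \<Longrightarrow> nonconstant_curve c \<Longrightarrow> curve_image c \<subseteq> A \<Longrightarrow> c \<notin> \<Gamma>2 \<Longrightarrow> ug_inequality v h c"
    using assms(3) unfolding weak_upper_gradient_def by blast
  have "ug_inequality w (\<lambda>x. g x + h x) c" if "ug_inequality u g c" "ug_inequality v h c" for c
    using that osc line_integral_superadditive[of g c h]
    unfolding ug_inequality_def by (meson add_mono order_trans)
  then show ?thesis
    using assms(2,3) \<Gamma>1(2) \<Gamma>2(2) zero_modulus_Un[OF \<mu> \<Gamma>1(1) \<Gamma>2(1)]
    unfolding weak_upper_gradient_def by (intro conjI exI[of _ "\<Gamma>1 \<union> \<Gamma>2"]) auto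
qed

lemma N11_iff:
  "u \<in> N11 \<mu> \<longleftrightarrow> u \<in> borel_measurable (caratheodory_space \<mu>) \<and>
     (\<integral>\<^sup>+ x. e2ennreal \<bar>u x\<bar> \<partial>caratheodory_space \<mu>) < \<infinity> \<and>
     (\<exists>g. weak_upper_gradient \<mu> UNIV u g \<and> (\<integral>\<^sup>+ x. g x \<partial>caratheodory_space \<mu>) < \<infinity>)"
  unfolding N11_def N11_norm_def by (auto simp: INF_less_iff)

lemma N11_comb:
  assumes \<mu>: "borel_regular_outer_measure \<mu>"
    and u: "u \<in> N11 \<mu>" and v: "v \<in> N11 \<mu>"
    and w: "w \<in> borel_measurable (caratheodory_space \<mu>)"
    and abs: "\<And>x. \<bar>w x\<bar> \<le> \<bar>u x\<bar> + \<bar>v x\<bar>"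
    and osc: "\<And>x y. osc (w x) (w y) \<le> osc (u x) (u y) + osc (v x) (v y)"
  shows "w \<in> N11 \<mu>"
proof -
  let ?M = "caratheodory_space \<mu>"
  obtain g where g: "weak_upper_gradient \<mu> UNIV u g" "(\<integral>\<^sup>+ x. g x \<partial>?M) < \<infinity>"
    using u by (auto simp: N11_iff)
  obtain h where h: "weak_upper_gradient \<mu> UNIV v h" "(\<integral>\<^sup>+ x. h x \<partial>?M) < \<infinity>"
    using v by (auto simp: N11_iff)
  have [measurable]: "u \<in> borel_measurable ?M" "v \<in> borel_measurable ?M"
    "g \<in> borel_measurable ?M" "h \<in> borel_measurable ?M"
    using u v g h by (auto simp: N11_iff weak_upper_gradient_def)
  have "(\<integral>\<^sup>+ x. e2ennreal \<bar>w x\<bar> \<partial>?M) \<le> (\<integral>\<^sup>+ x. e2ennreal \<bar>u x\<bar> + e2ennreal \<bar>v x\<bar> \<partial>?M)"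
  proof (rule nn_integral_mono)
    show "e2ennreal \<bar>w x\<bar> \<le> e2ennreal \<bar>u x\<bar> + e2ennreal \<bar>v x\<bar>" for x
      using e2ennreal_mono[OF abs[of x]]
      by (cases "u x"; cases "v x") (simp_all flip: ennreal_plus)
  qed
  also have "\<dots> < \<infinity>"
    using u v by (subst nn_integral_add) (auto simp: N11_iff)
  finally have "(\<integral>\<^sup>+ x. e2ennreal \<bar>w x\<bar> \<partial>?M) < \<infinity>" .
  moreover have "(\<integral>\<^sup>+ x. g x + h x \<partial>?M) < \<infinity>"
    using g h by (subst nn_integral_add) auto
  ultimately show ?thesis
    using w weak_upper_gradient_add[OF \<mu> g(1) h(1) osc] by (auto simp: N11_iff)
qed

lemma osc_eq_top: "\<bar>p\<bar> = \<infinity> \<or> \<bar>q\<bar> = \<infinity> \<Longrightarrow> osc p q = \<infinity>"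
  by (simp add: osc_def)

lemma osc_ereal: "osc (ereal a) (ereal b) = ennreal \<bar>a - b\<bar>"
  by (simp add: osc_def)

lemma osc_max: "osc (max p q) (max p' q') \<le> osc p p' + osc q q'"
proof (cases "\<bar>p\<bar> = \<infinity> \<or> \<bar>p'\<bar> = \<infinity> \<or> \<bar>q\<bar> = \<infinity> \<or> \<bar>q'\<bar> = \<infinity>")
  case True
  then show ?thesis
    using osc_eq_top[of p p'] osc_eq_top[of q q'] by auto
next
  case False
  then obtain a a' b b' where "p = ereal a" "p' = ereal a'" "q = ereal b" "q' = ereal b'"
    by auto
  then show ?thesis
    by (auto simp: osc_ereal ereal_max[symmetric] simp flip: ennreal_plus intro!: ennreal_leI
        simp del: ereal_max)
qed

lemma osc_diff: "osc (p - q) (p' - q') \<le> osc p p' + osc q q'"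
proof (cases "\<bar>p\<bar> = \<infinity> \<or> \<bar>p'\<bar> = \<infinity> \<or> \<bar>q\<bar> = \<infinity> \<or> \<bar>q'\<bar> = \<infinity>")
  case True
  then show ?thesis
    using osc_eq_top[of p p'] osc_eq_top[of q q'] by auto
next
  case False
  then obtain a a' b b' where "p = ereal a" "p' = ereal a'" "q = ereal b" "q' = ereal b'"
    by auto
  then show ?thesis
    by (auto simp: osc_ereal simp flip: ennreal_plus intro!: ennreal_leI)
qed

lemma N11_max:
  assumes "borel_regular_outer_measure \<mu>" and "u \<in> N11 \<mu>" and "v \<in> N11 \<mu>"
  shows "(\<lambda>x. max (u x) (v x)) \<in> N11 \<mu>"
proof (rule N11_comb[OF assms])
  show "(\<lambda>x. max (u x) (v x)) \<in> borel_measurable (caratheodory_space \<mu>)"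
    using assms by (auto simp: N11_iff)
  show "\<bar>max (u x) (v x)\<bar> \<le> \<bar>u x\<bar> + \<bar>v x\<bar>" for x
    by (cases "u x"; cases "v x") (auto simp: max_def)
qed (rule osc_max)

lemma N11_diff:
  assumes "borel_regular_outer_measure \<mu>" and "u \<in> N11 \<mu>" and "v \<in> N11 \<mu>"
  shows "(\<lambda>x. u x - v x) \<in> N11 \<mu>"
proof (rule N11_comb[OF assms])
  show "(\<lambda>x. u x - v x) \<in> borel_measurable (caratheodory_space \<mu>)"
    using assms by (auto simp: N11_iff)
  show "\<bar>u x - v x\<bar> \<le> \<bar>u x\<bar> + \<bar>v x\<bar>" for x
    by (cases "u x"; cases "v x") auto
qed (rule osc_diff)

lemma zero_in_N11: "(\<lambda>_. 0) \<in> N11 \<mu>"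
proof -
  have "weak_upper_gradient \<mu> UNIV (\<lambda>_. 0) (\<lambda>_. 0)"
    using zero_modulus_empty[of \<mu>]
    by (auto simp: weak_upper_gradient_def ug_inequality_def osc_def e2ennreal_neg)
  then show ?thesis
    by (auto simp: N11_iff e2ennreal_neg intro!: exI[of _ "\<lambda>_. 0"])
qed

lemma N11_c_subsupport:
  assumes "v \<in> N11_c \<mu> H" and "u \<in> N11 \<mu>" and "\<And>x. u x \<noteq> 0 \<Longrightarrow> v x \<noteq> 0"
  shows "u \<in> N11_c \<mu> H"
proof -
  have "closure {x. u x \<noteq> 0} \<subseteq> closure {x. v x \<noteq> 0}"
    using assms(3) by (intro closure_mono) auto
  moreover from this have "compact (closure {x. u x \<noteq> 0})"
    using assms(1) closed_Int_compact[of "closure {x. u x \<noteq> 0}" "closure {x. v x \<noteq> 0}"]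
    by (auto simp: N11_c_def Int_absorb2)
  ultimately show ?thesis
    using assms(1,2) by (auto simp: N11_c_def)
qed

lemma Cap1_mono: "A \<subseteq> B \<Longrightarrow> Cap1 \<mu> A \<le> Cap1 \<mu> B"
  unfolding Cap1_def by (intro INF_superset_mono) auto

lemma quasi_everywhere_in_quasicovering:
  assumes "quasicovering \<mu> U Us" and "\<And>j x. x \<in> Us j \<Longrightarrow> P x"
  shows "quasi_everywhere_in \<mu> U P"
proof -
  have "{x \<in> U. \<not> P x} \<subseteq> U - (\<Union>j. Us j)"
    using assms(2) by blast
  then have "Cap1 \<mu> {x \<in> U. \<not> P x} \<le> 0"
    using Cap1_mono assms(1) by (metis quasicovering_def)
  then show ?thesis
    by (simp add: quasi_everywhere_in_def)
qed

theorem proposition4p4: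
  fixes \<mu> :: "'a::complete_space set \<Rightarrow> ennreal"
    and U :: "'a set"
    and Us :: "nat \<Rightarrow> 'a set"
    and \<rho> :: "nat \<Rightarrow> 'a \<Rightarrow> ereal"
  assumes "borel_regular_outer_measure \<mu>"
    and "doubling \<mu>"
    and "poincare_1_1 \<mu>"
    and "quasiopen \<mu> U"
    and "strict_quasicovering \<mu> U Us"
    and "\<And>j. \<rho> j \<in> N11_c \<mu> U"
    and "\<And>j x. 0 \<le> \<rho> j x \<and> \<rho> j x \<le> 1"
    and "\<And>j x. x \<in> Us j \<Longrightarrow> \<rho> j x = 1"
  shows "\<exists>\<eta> :: nat \<Rightarrow> 'a \<Rightarrow> ereal.
     (\<forall>j. \<eta> j \<in> N11_c \<mu> U) \<and>
     \<eta> 0 = \<rho> 0 \<and>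
     (\<forall>j x. 0 \<le> \<eta> j x \<and> \<eta> j x \<le> \<rho> j x) \<and>
     quasi_everywhere_in \<mu> U (\<lambda>x. (\<lambda>j. \<eta> j x) sums 1) \<and>
     quasi_everywhere_in \<mu> U
       (\<lambda>x. \<exists>N. fine_neighborhood \<mu> x N \<and> finite {j. \<exists>y\<in>N. \<eta> j y \<noteq> 0})"
proof -
  define M :: "nat \<Rightarrow> 'a \<Rightarrow> ereal"
    where "M = rec_nat (\<lambda>_. 0) (\<lambda>j m x. max (m x) (\<rho> j x))"
  have M0: "M 0 = (\<lambda>_. 0)" and M_Suc: "M (Suc j) = (\<lambda>x. max (M j x) (\<rho> j x))" for j
    by (simp_all add: M_def)
  define \<eta> where "\<eta> j x = M (Suc j) x - M j x" for j x
  have \<rho>: "0 \<le> \<rho> j x" "\<rho> j x \<le> 1" for j x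
    using assms(7) by auto
  have M_bounds: "0 \<le> M j x \<and> M j x \<le> 1" for j x
    by (induction j) (use \<rho> in \<open>auto simp: M0 M_Suc le_max_iff_disj\<close>)
  have M_fin: "\<bar>M j x\<bar> \<noteq> \<infinity>" for j x
    using M_bounds[of j x] by (cases "M j x") auto
  have M_N11: "M j \<in> N11 \<mu>" for j
    using assms(6) by (induction j) (auto simp: M0 M_Suc N11_c_def zero_in_N11 intro!: N11_max assms(1))
  have \<eta>_bounds: "0 \<le> \<eta> j x \<and> \<eta> j x \<le> \<rho> j x" for j x
    using M_bounds[of j x] \<rho>[of j x] unfolding \<eta>_def M_Suc
    by (cases "M j x"; cases "\<rho> j x") (auto simp: max_def)
  have "\<eta> j \<in> N11_c \<mu> U" for j
  proof (rule N11_c_subsupport[OF assms(6)[of j]])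
    show "\<eta> j \<in> N11 \<mu>"
      unfolding \<eta>_def[abs_def] by (intro N11_diff assms(1) M_N11)
    show "\<rho> j x \<noteq> 0" if "\<eta> j x \<noteq> 0" for x
      using that \<eta>_bounds[of j x] by auto
  qed
  moreover have "\<eta> 0 = \<rho> 0"
    using \<rho> by (auto simp: \<eta>_def M0 M_Suc fun_eq_iff max_def)
  moreover have M_Us: "M n x = 1" if "x \<in> Us j" "j < n" for n j x
    using \<open>j < n\<close>
  proof (induction n)
    case (Suc n)
    then show ?case
      using M_bounds[of n x] \<rho>[of n x] assms(8)[OF \<open>x \<in> Us j\<close>]
      by (cases "j = n") (auto simp: M_Suc max_def)
  qed simp
  have sum_\<eta>: "(\<Sum>i<n. \<eta> i x) = M n x" for n x
  proof (induction n)
    case (Suc n)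
    then show ?case
      using M_fin[of n x] M_fin[of "Suc n" x]
      by (cases "M n x"; cases "M (Suc n) x") (auto simp: \<eta>_def)
  qed (simp add: M0)
  have qc: "quasicovering \<mu> U Us" and fo: "finely_open \<mu> (Us j)" for j
    using assms(5) by (auto simp: strict_quasicovering_def)
  have "quasi_everywhere_in \<mu> U (\<lambda>x. (\<lambda>j. \<eta> j x) sums 1)"
  proof (rule quasi_everywhere_in_quasicovering[OF qc])
    fix j x assume "x \<in> Us j"
    then have "\<forall>\<^sub>F n in sequentially. M n x = 1"
      by (intro eventually_mono[OF eventually_gt_at_top[of j]]) (rule M_Us)
    then show "(\<lambda>j. \<eta> j x) sums 1"
      unfolding sums_def sum_\<eta> by (rule tendsto_eventually)
  qed
  moreover have "quasi_everywhere_in \<mu> U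
       (\<lambda>x. \<exists>N. fine_neighborhood \<mu> x N \<and> finite {j. \<exists>y\<in>N. \<eta> j y \<noteq> 0})"
  proof (rule quasi_everywhere_in_quasicovering[OF qc])
    fix j x assume "x \<in> Us j"
    then have "fine_neighborhood \<mu> x (Us j)"
      using fo by (auto simp: fine_neighborhood_def)
    moreover have "\<eta> k y = 0" if "y \<in> Us j" "j < k" for k y
      using M_Us[OF that] M_Us[OF that(1), of "Suc k"] that by (simp add: \<eta>_def)
    then have "{k. \<exists>y\<in>Us j. \<eta> k y \<noteq> 0} \<subseteq> {..j}"
      by (auto simp: not_less[symmetric])
    then have "finite {k. \<exists>y\<in>Us j. \<eta> k y \<noteq> 0}"
      by (rule finite_subset) simp
    ultimately show "\<exists>N. fine_neighborhood \<mu> x N \<and> finite {j. \<exists>y\<in>N. \<eta> j y \<noteq> 0}"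
      by blast
  qed
  ultimately show ?thesis
    using \<eta>_bounds by blast
qed

end
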